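(* Let $\beta\in\{1,2\}$. For every $\alpha\in[0,1)$ and $\mu_0=\delta_0$ there exists a continuous family $(\mu_t)_{t\ge0}$ of probability measures on $\mathbf R$ satisfying, for every $t\ge0$ and every $f\in\mathcal C^2(\mathbf R)$ such that $f,f',f''$ have at most polynomial growth at infinity, $$\langle\mu_t,f\rangle=\langle\mu_0,f\rangle+\alpha\int_0^t ds\int_{\mathbf R}f'(x)\,\mu_s(dx)+\frac{\beta}{2}\int_0^t ds\int_{\mathbf R^2}\frac{f'(x)-f'(y)}{x-y}\,(|x|+|y|)\,\mu_s(dx)\mu_s(dy),$$ and such that $\mu_t((-\infty,0))>0$ for every $t>0$.
   Context: $\langle\mu,f\rangle=\int f\,d\mu$. The quotient $(f'(x)-f'(y))/(x-y)$ is interpreted as $f''(x)$ when $x=y$. Continuity of $(\mu_t)$ is with respect to weak convergence of probability measures. The parameter is $\beta=2$ in the complex-valued case and $\beta=1$ in the real-valued case. *)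

theory Defs
  imports "HOL-Probability.Probability"
begin

definition poly_growth :: "(real \<Rightarrow> real) \<Rightarrow> bool" where
  "poly_growth g \<longleftrightarrow> (\<exists>k::nat. g \<in> O[at_infinity](\<lambda>x. x ^ k))"

(* f is of class C^2 with f' = f1 and f'' = f2, and all three have polynomial growth. *)
definition test_function :: "(real \<Rightarrow> real) \<Rightarrow> (real \<Rightarrow> real) \<Rightarrow> (real \<Rightarrow> real) \<Rightarrow> bool" where
  "test_function f f1 f2 \<longleftrightarrow>
     (\<forall>x. (f has_real_derivative f1 x) (at x)) \<and>
     (\<forall>x. (f1 has_real_derivative f2 x) (at x)) \<and>
     continuous_on UNIV f2 \<and>
     poly_growth f \<and> poly_growth f1 \<and> poly_growth f2"

definition diff_quot :: "(real \<Rightarrow> real) \<Rightarrow> (real \<Rightarrow> real) \<Rightarrow> real \<Rightarrow> real \<Rightarrow> real" where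
  "diff_quot f1 f2 x y = (if x = y then f2 x else (f1 x - f1 y) / (x - y))"

(* Continuity on [0, \<infinity>) for the topology of weak convergence of probability measures, i.e. the
   initial topology of the maps sending a measure to its integral of a bounded continuous g. *)
definition weakly_continuous :: "(real \<Rightarrow> real measure) \<Rightarrow> bool" where
  "weakly_continuous \<mu> \<longleftrightarrow>
     (\<forall>g :: real \<Rightarrow> real. continuous_on UNIV g \<longrightarrow> bounded (range g) \<longrightarrow>
        continuous_on {0..} (\<lambda>t. LINT x|\<mu> t. g x))"

(* A Bochner integral is 0 when the integrand is not integrable, so the existence of every
   integral in the equation is stated explicitly. *)
definition satisfies_evolution ::
    "real \<Rightarrow> real \<Rightarrow> (real \<Rightarrow> real measure) \<Rightarrow> real \<Rightarrow>
     (real \<Rightarrow> real) \<Rightarrow> (real \<Rightarrow> real) \<Rightarrow> (real \<Rightarrow> real) \<Rightarrow> bool" where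
  "satisfies_evolution \<beta> \<alpha> \<mu> t f f1 f2 \<longleftrightarrow>
     integrable (\<mu> t) f \<and> integrable (\<mu> 0) f \<and>
     (\<forall>s\<in>{0..t}. integrable (\<mu> s) f1) \<and>
     set_integrable lborel {0..t} (\<lambda>s. LINT x|\<mu> s. f1 x) \<and>
     (\<forall>s\<in>{0..t}. integrable (\<mu> s \<Otimes>\<^sub>M \<mu> s)
        (\<lambda>(x, y). diff_quot f1 f2 x y * (\<bar>x\<bar> + \<bar>y\<bar>))) \<and>
     set_integrable lborel {0..t}
       (\<lambda>s. LINT (x, y)|(\<mu> s \<Otimes>\<^sub>M \<mu> s). diff_quot f1 f2 x y * (\<bar>x\<bar> + \<bar>y\<bar>)) \<and>
     (LINT x|\<mu> t. f x) =
       (LINT x|\<mu> 0. f x)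
       + \<alpha> * (LINT s:{0..t}|lborel. (LINT x|\<mu> s. f1 x))
       + \<beta> / 2 * (LINT s:{0..t}|lborel.
           (LINT (x, y)|(\<mu> s \<Otimes>\<^sub>M \<mu> s). diff_quot f1 f2 x y * (\<bar>x\<bar> + \<bar>y\<bar>)))"

end

theory Submission
  imports Defs
begin

text \<open>We look for a self-similar solution \<open>\<mu>\<^sub>t = law of t X\<close>. Then the equation becomes the
  stationary identity
  \<open>E[X g(X)] = \<alpha> E[g(X)] + (\<beta>/2) E[(g(X) - g(Y)) / (X - Y) (|X| + |Y|)]\<close> with \<open>Y\<close> an
  independent copy of \<open>X\<close> and \<open>g(x) = f'(s x)\<close>. Since \<open>(|x| + |y|) / (x - y) = 1\<close> for
  \<open>x > 0 > y\<close>, the positive and negative parts of the law interact only through their masses, and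
  each part has to be a Marchenko--Pastur law. With \<open>A = (\<beta> + \<alpha>) / 2\<close> and
  \<open>B = (\<alpha> - \<beta>) / 2 < 0\<close>, let \<open>Z\<close> have the Catalan numbers as moments and let \<open>X\<close> be
  \<open>A Z\<close> with probability \<open>A / \<beta>\<close> and \<open>B Z\<close> with probability \<open>- B / \<beta>\<close>.
  For monomials \<open>g\<close> the stationary identity reduces to the Catalan convolution, the mixed terms
  cancelling by antisymmetry. Weierstrass approximation of \<open>g'\<close> extends it to all \<open>C\<^sup>1\<close>
  functions \<open>g\<close>, and integrating over \<open>s\<close> gives the evolution equation.\<close>

section \<open>Catalan numbers\<close>

text \<open>In this form the Catalan convolution is the Vandermonde identity for
  \<open>(1/2) + (1/2) = 1\<close>.\<close>

definition catalan :: "nat \<Rightarrow> real" where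
  "catalan n = 2 * (-4) ^ n * ((1/2) gchoose Suc n)"

lemma catalan_0 [simp]: "catalan 0 = 1"
  by (simp add: catalan_def)

text \<open>The absorption law for \<open>(1/2) gchoose k\<close>, rescaled by the factor
  \<open>2 * (-4) ^ n\<close>. This first-order recurrence is what later identifies the Beta
  integrals with Catalan numbers.\<close>

lemma catalan_Suc: "real (n + 2) * catalan (Suc n) = 4 * (real n + 1/2) * catalan n"
proof -
  have "(1/2) * ((1/2::real) gchoose Suc n) =
      real (Suc n) * ((1/2) gchoose Suc n) + real (Suc (Suc n)) * ((1/2) gchoose Suc (Suc n))"
    by (rule gbinomial_mult_1)
  then have "real (n + 2) * ((1/2) gchoose Suc (Suc n)) = - (real n + 1/2) * ((1/2) gchoose Suc n)"
    by (simp add: algebra_simps)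
  then have "2 * (-4) ^ Suc n * (real (n + 2) * ((1/2) gchoose Suc (Suc n))) = 
       2 * (-4) ^ Suc n * (- (real n + 1/2) * ((1/2) gchoose Suc n))"
    by simp
  then show ?thesis
    unfolding catalan_def by (simp add: algebra_simps)
qed

lemma catalan_convolution: "(\<Sum>k\<le>n. catalan k * catalan (n - k)) = catalan (Suc n)"
proof -
  define h where "h k = ((1/2::real) gchoose k)" for k
  \<comment> \<open>Vandermonde gives \<open>1 gchoose (n + 2)\<close>, which vanishes because
    \<open>n + 2\<close> exceeds 1.\<close>
  have "(\<Sum>k\<le>Suc (Suc n). h k * h (Suc (Suc n) - k)) = (1/2 + 1/2) gchoose Suc (Suc n)"
    unfolding h_def using gbinomial_Vandermonde[of "1/2::real" "1/2" "Suc (Suc n)"]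
    by (simp add: atLeast0AtMost)
  also have "\<dots> = 0"
    using binomial_gbinomial[of 1 "Suc (Suc n)", where 'a = real] by simp
  \<comment> \<open>The end terms \<open>k = 0\<close> and \<open>k = n + 2\<close> both equal
    \<open>h (n + 2)\<close>, since \<open>h 0 = 1\<close>; moving them to the right gives the
    factor \<open>- 2\<close>.\<close>
  finally have "(\<Sum>k\<le>n. h (Suc k) * h (Suc (n - k))) = - 2 * h (Suc (Suc n))"
    by (subst (asm) sum.atMost_Suc_shift) (simp add: sum.atMost_Suc Suc_diff_le h_def)
  moreover have "catalan k * catalan (n - k) = 4 * (-4) ^ n * (h (Suc k) * h (Suc (n - k)))"
    if "k \<le> n" for k
  proof -
    have "(-4::real) ^ n = (-4) ^ k * (-4) ^ (n - k)"
      using that by (simp flip: power_add)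
    then show ?thesis by (simp add: catalan_def h_def)
  qed
  ultimately have "(\<Sum>k\<le>n. catalan k * catalan (n - k)) = 4 * (-4) ^ n * (- 2 * h (Suc (Suc n)))"
    by (simp del: mult_minus_left flip: sum_distrib_left)
  then show ?thesis
    by (simp add: catalan_def h_def)
qed

text \<open>In the expanded products the pure powers collect the Catalan convolution, while the two
  mixed sums are exchanged by \<open>k \<mapsto> n - k\<close> and cancel. For \<open>k > 0\<close>
  the factors are, up to normalisation, the moments \<open>E[|X| X ^ (k - 1)]\<close> and
  \<open>E[X ^ (n - k)]\<close> of the two-sided law; the term \<open>k = 0\<close> will give the
  drift.\<close>

lemma catalan_moment_identity:
  fixes A B :: real
  shows "(\<Sum>k\<le>n. (A ^ Suc k + B ^ Suc k) * (A ^ Suc (n - k) - B ^ Suc (n - k)) *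
            (catalan k * catalan (n - k))) = (A ^ (n + 2) - B ^ (n + 2)) * catalan (Suc n)"
proof -
  define S where "S = (\<Sum>k\<le>n. B ^ Suc k * A ^ Suc (n - k) * (catalan k * catalan (n - k)))"
  have S': "S = (\<Sum>k\<le>n. A ^ Suc k * B ^ Suc (n - k) * (catalan k * catalan (n - k)))"
    unfolding S_def
    by (rule sum.reindex_bij_witness[where i = "\<lambda>k. n - k" and j = "\<lambda>k. n - k"]) auto
  have "(A ^ Suc k + B ^ Suc k) * (A ^ Suc (n - k) - B ^ Suc (n - k)) * (catalan k * catalan (n - k)) =
      (A ^ (n + 2) - B ^ (n + 2)) * (catalan k * catalan (n - k)) +
      (B ^ Suc k * A ^ Suc (n - k) * (catalan k * catalan (n - k)) -
       A ^ Suc k * B ^ Suc (n - k) * (catalan k * catalan (n - k)))" if "k \<le> n" for k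
  proof -
    have *: "x ^ (n + 2) = x ^ Suc k * x ^ Suc (n - k)" for x :: real
      using that by (simp flip: power_add power_Suc)
    have "(a + b) * (c - d) * e = (a * c - b * d) * e + (b * c * e - a * d * e)" for a b c d e :: real
      by (simp add: algebra_simps)
    then show ?thesis unfolding * .
  qed
  then have "(\<Sum>k\<le>n. (A ^ Suc k + B ^ Suc k) * (A ^ Suc (n - k) - B ^ Suc (n - k)) *
            (catalan k * catalan (n - k))) =
       (\<Sum>k\<le>n. (A ^ (n + 2) - B ^ (n + 2)) * (catalan k * catalan (n - k)) +
      (B ^ Suc k * A ^ Suc (n - k) * (catalan k * catalan (n - k)) -
       A ^ Suc k * B ^ Suc (n - k) * (catalan k * catalan (n - k))))"
    by (intro sum.cong refl) (simp only: atMost_iff)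
  also have "\<dots> = (\<Sum>k\<le>n. (A ^ (n + 2) - B ^ (n + 2)) * (catalan k * catalan (n - k))) + (S - S)"
    by (subst (2) S') (simp only: S_def sum.distrib sum_subtractf)
  finally show ?thesis
    by (simp only: sum_distrib_left[symmetric] catalan_convolution diff_self add_0_right)
qed

text \<open>Both sides obey the same first-order recurrence in \<open>n\<close>:
  \<open>catalan_Suc\<close> on one side, the functional equation of Beta on the other.\<close>

lemma catalan_Beta: "4 ^ n * Beta (real n + 1/2) (3/2) = catalan n * Beta (1/2) (3/2)"
proof (induction n)
  case (Suc n)
  have "real n + 1/2 \<notin> \<int>\<^sub>\<le>\<^sub>0"
    by (auto dest: nonpos_Ints_nonpos)
  then have "real (n + 2) * Beta (real n + 1/2 + 1) (3/2) = (real n + 1/2) * Beta (real n + 1/2) (3/2)"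
    using Beta_plus1_left[of "real n + 1/2" "3/2"] by simp
  then have "4 ^ Suc n * (real (n + 2) * Beta (real n + 1/2 + 1) (3/2)) =
      4 ^ Suc n * ((real n + 1/2) * Beta (real n + 1/2) (3/2))"
    by simp
  then have "real (n + 2) * (4 ^ Suc n * Beta (real (Suc n) + 1/2) (3/2)) =
      4 * (real n + 1/2) * (4 ^ n * Beta (real n + 1/2) (3/2))"
    by (simp add: mult_ac add_ac)
  also have "\<dots> = real (n + 2) * (catalan (Suc n) * Beta (1/2) (3/2))"
    by (simp only: Suc.IH catalan_Suc mult.assoc[symmetric])
  finally show ?case
    by (simp only: mult_cancel_left) simp
qed simp

section \<open>The Marchenko--Pastur law\<close>

text \<open>Four times a Beta(1/2, 3/2) variable has the Marchenko--Pastur law of ratio 1, that is, the law of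
  the square of a standard semicircular variable.\<close>

definition beta_density :: "real \<Rightarrow> real" where
  "beta_density y = indicator {0..1} y * (y powr (-1/2) * (1 - y) powr (1/2)) / Beta (1/2) (3/2)"

definition beta_distribution :: "real measure" where
  "beta_distribution = density lborel (\<lambda>y. ennreal (beta_density y))"

lemma Beta_half_pos: "Beta (1/2) (3/2 :: real) > 0"
  by (simp add: Beta_def Gamma_real_pos)

lemma beta_density_nonneg: "0 \<le> beta_density y"
  using Beta_half_pos by (simp add: beta_density_def)

lemma beta_density_measurable [measurable]: "beta_density \<in> borel_measurable borel"
  unfolding beta_density_def by measurable

lemma has_bochner_integral_beta_density:
  "has_bochner_integral lborel (\<lambda>y. beta_density y * y ^ n) (catalan n / 4 ^ n)"
proof -
  define g :: "real \<Rightarrow> real" where "g = (\<lambda>y. y powr (real n + 1/2 - 1) * (1 - y) powr (3/2 - 1))"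
  \<comment> \<open>At \<open>y = 0\<close> both sides vanish because \<open>0 powr a = 0\<close>,
    and for \<open>y < 0\<close> because the point lies outside \<open>{0..1}\<close>.\<close>
  have eq: "beta_density y * y ^ n = (if y \<in> {0..1} then g y else 0) / Beta (1/2) (3/2)" for y :: real
  proof (cases "0 < y")
    case True
    then have "y ^ n * y powr (-1/2) = y powr (real n + 1/2 - 1)"
      by (simp add: powr_realpow[symmetric] flip: powr_add)
    then show ?thesis by (simp add: beta_density_def g_def indicator_def mult_ac)
  qed (auto simp: beta_density_def g_def indicator_def)
  \<comment> \<open>\<open>has_integral_Beta_real\<close> concerns the gauge integral; nonnegativity
    of the integrand turns it into a Lebesgue integral.\<close>
  have "((\<lambda>y. if y \<in> {0..1} then g y else 0) has_integral Beta (real n + 1/2) (3/2)) UNIV"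
    unfolding g_def has_integral_restrict_UNIV by (rule has_integral_Beta_real) auto
  moreover have "0 \<le> Beta (real n + 1/2) (3/2)"
    by (simp add: Beta_def Gamma_real_pos less_imp_le)
  moreover have [measurable]: "g \<in> borel_measurable borel"
    unfolding g_def by measurable
  ultimately have "has_bochner_integral lborel (\<lambda>y. if y \<in> {0..1} then g y else 0)
      (Beta (real n + 1/2) (3/2))"
    by (intro has_bochner_integral_nn_integral nn_integral_has_integral_lborel)
       (auto simp: g_def)
  then have "has_bochner_integral lborel (\<lambda>y. beta_density y * y ^ n)
      (Beta (real n + 1/2) (3/2) / Beta (1/2) (3/2))"
    unfolding eq by (rule has_bochner_integral_divide_zero)
  also have "Beta (real n + 1/2) (3/2) / Beta (1/2) (3/2) = catalan n / 4 ^ n"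
    using catalan_Beta[of n] Beta_half_pos by (simp add: field_simps)
  finally show ?thesis .
qed

lemma integral_beta_distribution:
  "(LINT y|beta_distribution. y ^ n) = catalan n / 4 ^ n"
  using has_bochner_integral_beta_density[of n]
  by (simp add: beta_distribution_def integral_density beta_density_nonneg has_bochner_integral_iff)

lemma AE_beta_distribution: "AE y in beta_distribution. y \<in> {0..1}"
  unfolding beta_distribution_def
  by (subst AE_density) (auto intro!: AE_I2 simp: beta_density_def indicator_def)

text \<open>Total mass one is the zeroth moment, \<open>catalan 0 = 1\<close>.\<close>

lemma real_distribution_beta: "real_distribution beta_distribution"
proof (intro real_distribution.intro prob_spaceI real_distribution_axioms.intro)
  have "emeasure beta_distribution (space beta_distribution) = (\<integral>\<^sup>+ y. ennreal (beta_density y) \<partial>lborel)"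
    unfolding beta_distribution_def by (subst emeasure_density) auto
  also have "\<dots> = ennreal (LINT y|lborel. beta_density y)"
    using has_bochner_integral_beta_density[of 0]
    by (intro nn_integral_eq_integral) (auto simp: has_bochner_integral_iff beta_density_nonneg)
  also have "\<dots> = 1"
    using has_bochner_integral_beta_density[of 0] by (simp add: has_bochner_integral_iff)
  finally show "emeasure beta_distribution (space beta_distribution) = 1" .
qed (simp add: beta_distribution_def)

section \<open>Compactly supported distributions\<close>

text \<open>Under an almost sure bound, integrands have to be bounded on \<open>[-R, R]\<close>
  only, which holds for every continuous function.\<close>

locale bounded_real_distribution = real_distribution +
  fixes R :: real
  assumes R_pos: "R > 0" and AE_bounded: "AE x in M. \<bar>x\<bar> \<le> R"
begin

sublocale pair: pair_prob_space M M ..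

lemma integrable_bounded_on:
  fixes h :: "real \<Rightarrow> real"
  assumes "h \<in> borel_measurable borel" "\<And>x. \<bar>x\<bar> \<le> R \<Longrightarrow> \<bar>h x\<bar> \<le> K"
  shows "integrable M h"
proof (rule integrable_const_bound)
  show "AE x in M. norm (h x) \<le> K" using AE_bounded by eventually_elim (auto simp: assms)
qed (use assms in simp)

lemma AE_pair_bounded: "AE z in M \<Otimes>\<^sub>M M. \<bar>fst z\<bar> \<le> R \<and> \<bar>snd z\<bar> \<le> R"
proof (rule pair.AE_pair_measure)
  show "AE x in M. AE y in M. \<bar>fst (x, y)\<bar> \<le> R \<and> \<bar>snd (x, y)\<bar> \<le> R"
    using AE_bounded
  proof eventually_elim
    case (elim x)
    with AE_bounded show ?case by auto
  qed
qed measurable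

lemma integrable_pair_bounded_on:
  fixes h :: "real \<times> real \<Rightarrow> real"
  assumes "h \<in> borel_measurable (borel \<Otimes>\<^sub>M borel)"
    "\<And>x y. \<bar>x\<bar> \<le> R \<Longrightarrow> \<bar>y\<bar> \<le> R \<Longrightarrow> \<bar>h (x, y)\<bar> \<le> K"
  shows "integrable (M \<Otimes>\<^sub>M M) h"
proof (rule pair.P.integrable_const_bound)
  show "AE z in M \<Otimes>\<^sub>M M. norm (h z) \<le> K"
    using AE_pair_bounded by eventually_elim (use assms(2) in auto)
  have "sets (M \<Otimes>\<^sub>M M) = sets (borel \<Otimes>\<^sub>M borel)" by (intro sets_pair_measure_cong) auto
  with assms(1) show "h \<in> borel_measurable (M \<Otimes>\<^sub>M M)" by (simp cong: measurable_cong_sets)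
qed

lemma abs_integral_le:
  fixes h :: "real \<Rightarrow> real"
  assumes "h \<in> borel_measurable borel" "\<And>x. \<bar>x\<bar> \<le> R \<Longrightarrow> \<bar>h x\<bar> \<le> K"
  shows "\<bar>LINT x|M. h x\<bar> \<le> K"
proof -
  have "\<bar>LINT x|M. h x\<bar> \<le> (LINT x|M. \<bar>h x\<bar>)"
    by (rule integral_abs_bound)
  also have "\<dots> \<le> (LINT x|M. K)"
    using AE_bounded assms integrable_bounded_on[OF assms]
    by (intro integral_mono_AE) auto
  finally show ?thesis using prob_space by simp
qed

lemma abs_pair_integral_le:
  fixes h :: "real \<times> real \<Rightarrow> real"
  assumes "h \<in> borel_measurable (borel \<Otimes>\<^sub>M borel)"
    "\<And>x y. \<bar>x\<bar> \<le> R \<Longrightarrow> \<bar>y\<bar> \<le> R \<Longrightarrow> \<bar>h (x, y)\<bar> \<le> K"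
  shows "\<bar>LINT z|(M \<Otimes>\<^sub>M M). h z\<bar> \<le> K"
proof -
  have "\<bar>LINT z|(M \<Otimes>\<^sub>M M). h z\<bar> \<le> (LINT z|(M \<Otimes>\<^sub>M M). \<bar>h z\<bar>)"
    by (rule integral_abs_bound)
  also have "\<dots> \<le> (LINT z|(M \<Otimes>\<^sub>M M). K)"
  proof (intro integral_mono_AE)
    show "AE z in M \<Otimes>\<^sub>M M. \<bar>h z\<bar> \<le> K"
      using AE_pair_bounded by eventually_elim (use assms(2) in auto)
  qed (use integrable_pair_bounded_on[OF assms] in auto)
  finally show ?thesis by (simp add: pair.P.prob_space)
qed

end

section \<open>Continuously differentiable functions and their difference quotients\<close>

definition C1 :: "(real \<Rightarrow> real) \<Rightarrow> (real \<Rightarrow> real) \<Rightarrow> bool" where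
  "C1 g g' \<longleftrightarrow> (\<forall>x. (g has_real_derivative g' x) (at x)) \<and> continuous_on UNIV g'"

lemma C1_continuous: "C1 g g' \<Longrightarrow> continuous_on UNIV g"
  by (auto simp: C1_def intro!: continuous_at_imp_continuous_on DERIV_isCont)

lemma C1_diff: "C1 g g' \<Longrightarrow> C1 h h' \<Longrightarrow> C1 (\<lambda>x. g x - h x) (\<lambda>x. g' x - h' x)"
  by (auto simp: C1_def intro!: derivative_eq_intros continuous_intros)

lemma C1_cmult: "C1 g g' \<Longrightarrow> C1 (\<lambda>x. c * g x) (\<lambda>x. c * g' x)"
  by (auto simp: C1_def intro!: derivative_eq_intros continuous_intros)

lemma C1_sum: "(\<And>i. i \<in> I \<Longrightarrow> C1 (g i) (g' i)) \<Longrightarrow> C1 (\<lambda>x. \<Sum>i\<in>I. g i x) (\<lambda>x. \<Sum>i\<in>I. g' i x)"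
  by (auto simp: C1_def intro!: DERIV_sum continuous_on_sum)

lemma C1_power: "C1 (\<lambda>x. x ^ n) (\<lambda>x. real n * x ^ (n - 1))"
  by (auto simp: C1_def intro!: derivative_eq_intros continuous_intros)

lemma C1_measurable:
  assumes "C1 g g'"
  shows "g \<in> borel_measurable borel" "g' \<in> borel_measurable borel"
  using assms C1_continuous[OF assms] by (auto simp: C1_def intro!: borel_measurable_continuous_onI)

lemma C1_bounded:
  assumes "C1 g g'"
  shows "\<exists>K. \<forall>x. \<bar>x\<bar> \<le> r \<longrightarrow> \<bar>g x\<bar> \<le> K \<and> \<bar>g' x\<bar> \<le> K"
proof -
  have *: "\<exists>K. \<forall>x. \<bar>x\<bar> \<le> r \<longrightarrow> \<bar>h x\<bar> \<le> K" if "continuous_on UNIV h" for h :: "real \<Rightarrow> real"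
  proof -
    have "compact (h ` {-r..r})"
      using that by (intro compact_continuous_image) (auto intro: continuous_on_subset)
    then obtain K where "\<forall>y\<in>h ` {-r..r}. norm y \<le> K"
      using compact_imp_bounded bounded_iff by metis
    then show ?thesis by (intro exI[of _ K]) (auto simp: abs_le_iff)
  qed
  obtain K1 K2 where "\<forall>x. \<bar>x\<bar> \<le> r \<longrightarrow> \<bar>g x\<bar> \<le> K1" "\<forall>x. \<bar>x\<bar> \<le> r \<longrightarrow> \<bar>g' x\<bar> \<le> K2"
    using *[of g] *[of g'] C1_continuous[OF assms] assms by (auto simp: C1_def)
  then show ?thesis by (intro exI[of _ "max K1 K2"]) fastforce
qed

lemma diff_quot_measurable [measurable]:
  assumes [measurable]: "g \<in> borel_measurable borel" "g' \<in> borel_measurable borel"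
  shows "(\<lambda>z. diff_quot g g' (fst z) (snd z)) \<in> borel_measurable (borel \<Otimes>\<^sub>M borel)"
  unfolding diff_quot_def by measurable

lemma C1_MVT:
  assumes "C1 g g'" "\<And>x. \<bar>x\<bar> \<le> r \<Longrightarrow> \<bar>g' x\<bar> \<le> K" "\<bar>x\<bar> \<le> r" "\<bar>y\<bar> \<le> r"
  shows "\<bar>g x - g y\<bar> \<le> K * \<bar>x - y\<bar>"
proof -
  have "norm (g x - g y) \<le> K * norm (x - y)"
    using assms
    by (intro field_differentiable_bound[of "{-r..r}" g g' K x y])
       (auto simp: C1_def abs_le_iff intro: has_field_derivative_at_within)
  then show ?thesis by simp
qed

text \<open>Mean value theorem off the diagonal, the bound on \<open>g'\<close> itself on it. Hence
  uniform smallness of \<open>g'\<close> alone controls the interaction term.\<close>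

lemma diff_quot_bounded:
  assumes "C1 g g'" "\<And>x. \<bar>x\<bar> \<le> r \<Longrightarrow> \<bar>g' x\<bar> \<le> K" "\<bar>x\<bar> \<le> r" "\<bar>y\<bar> \<le> r"
  shows "\<bar>diff_quot g g' x y\<bar> \<le> K"
  using C1_MVT[OF assms] assms(2)[OF assms(3)] by (auto simp: diff_quot_def divide_simps)

text \<open>The factorisation of \<open>x ^ n - y ^ n\<close>; on the diagonal the \<open>n\<close>
  equal summands give the derivative. It splits the double integral of a monomial into products of
  one-dimensional moments.\<close>

lemma diff_quot_power:
  "diff_quot (\<lambda>x. x ^ n) (\<lambda>x. real n * x ^ (n - 1)) x y = (\<Sum>k<n. x ^ k * y ^ (n - 1 - k))"
proof (cases "x = y")
  case True
  have "x ^ k * x ^ (n - 1 - k) = x ^ (n - 1)" if "k < n" for k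
    using that by (simp flip: power_add)
  then show ?thesis using True by (simp add: diff_quot_def)
next
  case False
  then show ?thesis
    by (simp add: diff_quot_def power_diff_sumr2[of x n y] mult.commute)
qed

section \<open>The stationary profile\<close>

text \<open>The masses \<open>A / (A - B)\<close> and \<open>- B / (A - B)\<close> of the two sides are proportional to their
  lengths.\<close>

definition two_sided_law :: "real \<Rightarrow> real \<Rightarrow> real measure" where
  "two_sided_law A B = distr (beta_distribution \<Otimes>\<^sub>M measure_pmf (bernoulli_pmf (A / (A - B)))) borel
     (\<lambda>(y, s). 4 * (if s then A else B) * y)"

context
  fixes A B :: real
  assumes A_pos: "A > 0" and B_neg: "B < 0"
begin

interpretation beta: real_distribution beta_distribution by (rule real_distribution_beta)
interpretation bp: pair_prob_space beta_distribution "measure_pmf (bernoulli_pmf (A / (A - B)))"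
  by unfold_locales

lemma two_sided_law_measurable [measurable]:
  "(\<lambda>(y, s). 4 * (if s then A else B) * y) \<in>
     borel_measurable (beta_distribution \<Otimes>\<^sub>M measure_pmf (bernoulli_pmf (A / (A - B))))"
  by measurable

lemma bounded_real_distribution_two_sided_law:
  "bounded_real_distribution (two_sided_law A B) (4 * (A - B))"
proof -
  have "real_distribution (two_sided_law A B)"
    unfolding two_sided_law_def
    by (intro real_distribution.intro bp.P.prob_space_distr real_distribution_axioms.intro) simp_all
  moreover have "AE z in beta_distribution \<Otimes>\<^sub>M measure_pmf (bernoulli_pmf (A / (A - B))).
      \<bar>case z of (y, s) \<Rightarrow> 4 * (if s then A else B) * y\<bar> \<le> 4 * (A - B)"
  proof (rule bp.AE_pair_measure)
    \<comment> \<open>Both \<open>A\<close> and \<open>- B\<close> are at most \<open>A - B\<close>,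
      so one radius covers the two sides.\<close>
    have "\<bar>4 * (if s then A else B) * y\<bar> \<le> 4 * (A - B)" if "y \<in> {0..1}" for y s
    proof -
      have "\<bar>4 * (if s then A else B)\<bar> * \<bar>y\<bar> \<le> (4 * (A - B)) * 1"
        using that A_pos B_neg by (intro mult_mono) auto
      then show ?thesis by (simp only: abs_mult mult_1_right)
    qed
    then show "AE y in beta_distribution. AE s in measure_pmf (bernoulli_pmf (A / (A - B))).
        \<bar>case (y, s) of (y, s) \<Rightarrow> 4 * (if s then A else B) * y\<bar> \<le> 4 * (A - B)"
      by (intro eventually_mono[OF AE_beta_distribution] AE_I2) simp
  qed measurable
  then have "AE x in two_sided_law A B. \<bar>x\<bar> \<le> 4 * (A - B)"
    unfolding two_sided_law_def by (subst AE_distr_iff) auto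
  ultimately show ?thesis
    using A_pos B_neg by (auto simp: bounded_real_distribution_def bounded_real_distribution_axioms_def)
qed

interpretation law: bounded_real_distribution "two_sided_law A B" "4 * (A - B)"
  by (rule bounded_real_distribution_two_sided_law)

text \<open>Fubini, integrating out the coin first. The factor \<open>A - B\<close> clears the
  denominators of the two masses.\<close>

lemma integral_two_sided_law:
  assumes [measurable]: "h \<in> borel_measurable borel"
    and bound: "\<And>x. \<bar>x\<bar> \<le> 4 * (A - B) \<Longrightarrow> \<bar>h x\<bar> \<le> K"
  shows "(A - B) * (LINT x|two_sided_law A B. h x) =
     (LINT y|beta_distribution. A * h (4 * A * y) - B * h (4 * B * y))"
proof -
  let ?p = "A / (A - B)"
  let ?X = "\<lambda>(y, s). 4 * (if s then A else B) * y"
  let ?P = "beta_distribution \<Otimes>\<^sub>M measure_pmf (bernoulli_pmf ?p)"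
  have p: "0 \<le> ?p" "?p \<le> 1" using A_pos B_neg by auto
  have "integrable (two_sided_law A B) h"
    by (rule law.integrable_bounded_on[OF assms])
  then have "integrable ?P (\<lambda>z. h (?X z))"
    unfolding two_sided_law_def by (subst (asm) integrable_distr_eq) auto
  then have "(LINT z|?P. h (?X z)) =
      (LINT y|beta_distribution. LINT s|measure_pmf (bernoulli_pmf ?p). h (?X (y, s)))"
    by (rule bp.integral_fst'[symmetric])
  also have "\<dots> = (LINT y|beta_distribution. h (4 * A * y) * ?p + h (4 * B * y) * (1 - ?p))"
    using p by simp
  finally have "(A - B) * (LINT x|two_sided_law A B. h x) =
      (LINT y|beta_distribution. (A - B) * (h (4 * A * y) * ?p + h (4 * B * y) * (1 - ?p)))"
    unfolding two_sided_law_def by (subst integral_distr) auto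
  also have "\<dots> = (LINT y|beta_distribution. A * h (4 * A * y) - B * h (4 * B * y))"
  proof (intro Bochner_Integration.integral_cong refl)
    fix y
    have "(A - B) * ?p = A" "(A - B) * (1 - ?p) = - B"
      using A_pos B_neg by (simp_all add: right_diff_distrib)
    then have "h (4 * A * y) * ((A - B) * ?p) + h (4 * B * y) * ((A - B) * (1 - ?p)) =
        A * h (4 * A * y) - B * h (4 * B * y)"
      by simp
    then show "(A - B) * (h (4 * A * y) * ?p + h (4 * B * y) * (1 - ?p)) =
        A * h (4 * A * y) - B * h (4 * B * y)"
      by (simp only: distrib_left mult_ac)
  qed
  finally show ?thesis .
qed

text \<open>Each side contributes its mass times the scaled Catalan moment; the mass supplies the
  extra power of \<open>A\<close> or \<open>B\<close>.\<close>

lemma moment_two_sided_law: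
  "(A - B) * (LINT x|two_sided_law A B. x ^ n) = (A ^ Suc n - B ^ Suc n) * catalan n"
proof -
  have "(A - B) * (LINT x|two_sided_law A B. x ^ n) =
      (LINT y|beta_distribution. A * (4 * A * y) ^ n - B * (4 * B * y) ^ n)"
  proof (rule integral_two_sided_law)
    show "\<bar>x ^ n\<bar> \<le> (4 * (A - B)) ^ n" if "\<bar>x\<bar> \<le> 4 * (A - B)" for x
      using power_mono[OF that, of n] by (simp add: power_abs)
  qed simp
  also have "\<dots> = (LINT y|beta_distribution. (A ^ Suc n - B ^ Suc n) * 4 ^ n * y ^ n)"
    by (simp add: power_mult_distrib algebra_simps)
  also have "\<dots> = (A ^ Suc n - B ^ Suc n) * 4 ^ n * (catalan n / 4 ^ n)"
    by (simp only: integral_mult_right_zero integral_beta_distribution)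
  finally show ?thesis by simp
qed

text \<open>The absolute value flips the sign of the negative side, so the difference in
  \<open>moment_two_sided_law\<close> becomes a sum, with the exponent raised by one.\<close>

lemma abs_moment_two_sided_law:
  "(A - B) * (LINT x|two_sided_law A B. \<bar>x\<bar> * x ^ n) = (A ^ (n + 2) + B ^ (n + 2)) * catalan (Suc n)"
proof -
  have "(A - B) * (LINT x|two_sided_law A B. \<bar>x\<bar> * x ^ n) =
      (LINT y|beta_distribution. A * (\<bar>4 * A * y\<bar> * (4 * A * y) ^ n) - B * (\<bar>4 * B * y\<bar> * (4 * B * y) ^ n))"
  proof (rule integral_two_sided_law)
    show "\<bar>\<bar>x\<bar> * x ^ n\<bar> \<le> (4 * (A - B)) ^ Suc n" if "\<bar>x\<bar> \<le> 4 * (A - B)" for x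
      using power_mono[OF that, of "Suc n"] by (simp add: power_abs abs_mult)
  qed simp
  also have "\<dots> = (LINT y|beta_distribution. (A ^ (n + 2) + B ^ (n + 2)) * 4 ^ Suc n * y ^ Suc n)"
  proof (rule integral_cong_AE)
    show "AE y in beta_distribution. A * (\<bar>4 * A * y\<bar> * (4 * A * y) ^ n) - B * (\<bar>4 * B * y\<bar> * (4 * B * y) ^ n)
        = (A ^ (n + 2) + B ^ (n + 2)) * 4 ^ Suc n * y ^ Suc n"
      using AE_beta_distribution
    proof eventually_elim
      case (elim y)
      then have "\<bar>4 * A * y\<bar> = 4 * A * y" "\<bar>4 * B * y\<bar> = - (4 * B * y)"
        using A_pos B_neg by (auto simp: abs_mult)
      then show ?case by (simp add: power_mult_distrib algebra_simps)
    qed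
  qed measurable
  also have "\<dots> = (A ^ (n + 2) + B ^ (n + 2)) * 4 ^ Suc n * (catalan (Suc n) / 4 ^ Suc n)"
    by (simp only: integral_mult_right_zero integral_beta_distribution)
  finally show ?thesis by simp
qed

end

section \<open>The stationary equation\<close>

lemma diff_quot_diff:
  "diff_quot (\<lambda>x. g x - h x) (\<lambda>x. g' x - h' x) x y = diff_quot g g' x y - diff_quot h h' x y"
  by (simp add: diff_quot_def diff_divide_distrib)

lemma diff_quot_lincomb:
  "diff_quot (\<lambda>x. \<Sum>i\<in>I. c i * g i x) (\<lambda>x. \<Sum>i\<in>I. c i * g' i x) x y =
     (\<Sum>i\<in>I. c i * diff_quot (g i) (g' i) x y)"
  by (simp add: diff_quot_def sum_divide_distrib right_diff_distrib flip: sum_subtractf)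

text \<open>Weierstrass is applied to \<open>g'\<close> and the approximant is then integrated, so
  that one polynomial approximates \<open>g\<close> together with its derivative.\<close>

lemma C1_approx_polynomial:
  assumes "C1 g g'" "0 < \<epsilon>"
  shows "\<exists>n c. (\<Sum>i\<le>n. c i * 0 ^ i) = g 0 \<and>
     (\<forall>x. \<bar>x\<bar> \<le> r \<longrightarrow> \<bar>g' x - (\<Sum>i\<le>n. c i * (real i * x ^ (i - 1)))\<bar> \<le> \<epsilon>)"
proof -
  have "continuous_on {-r..r} g'" using assms(1) by (auto simp: C1_def intro: continuous_on_subset)
  with Stone_Weierstrass_real_polynomial_function[of "{-r..r}" g' \<epsilon>] assms(2)
  obtain q where q: "real_polynomial_function q" "\<And>x. x \<in> {-r..r} \<Longrightarrow> \<bar>g' x - q x\<bar> < \<epsilon>"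
    by auto
  from q(1) obtain a n where q_eq: "q = (\<lambda>x. \<Sum>i\<le>n. a i * x ^ i)"
    unfolding real_polynomial_function_iff_sum by auto
  \<comment> \<open>Coefficients of the antiderivative of \<open>q\<close> with constant term
    \<open>g 0\<close>; at 0 only \<open>c 0\<close> survives, since
    \<open>0 ^ 0 = 1\<close>.\<close>
  define c where "c i = (case i of 0 \<Rightarrow> g 0 | Suc j \<Rightarrow> a j / real (Suc j))" for i
  have "(\<Sum>i\<le>Suc n. c i * 0 ^ i) = g 0"
    by (subst sum.atMost_Suc_shift) (simp add: c_def)
  moreover have "(\<Sum>i\<le>Suc n. c i * (real i * x ^ (i - 1))) = q x" for x
    by (subst sum.atMost_Suc_shift) (simp add: c_def q_eq)
  moreover have "\<bar>g' x - q x\<bar> \<le> \<epsilon>" if "\<bar>x\<bar> \<le> r" for x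
  proof -
    have "x \<in> {-r..r}" using that by auto
    from q(2)[OF this] show ?thesis by simp
  qed
  ultimately show ?thesis
    by (intro exI[of _ "Suc n"] exI[of _ c]) simp
qed

context bounded_real_distribution
begin

lemma
  assumes "C1 g g'"
  shows integrable_C1: "integrable M g"
    and integrable_mult_C1: "integrable M (\<lambda>x. x * g x)"
    and integrable_diff_quot: "integrable (M \<Otimes>\<^sub>M M) (\<lambda>z. diff_quot g g' (fst z) (snd z) * (\<bar>fst z\<bar> + \<bar>snd z\<bar>))"
proof -
  note [measurable] = C1_measurable[OF assms]
  obtain K where K: "\<And>x. \<bar>x\<bar> \<le> R \<Longrightarrow> \<bar>g x\<bar> \<le> K" "\<And>x. \<bar>x\<bar> \<le> R \<Longrightarrow> \<bar>g' x\<bar> \<le> K"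
    using C1_bounded[OF assms, of R] by blast
  then have "0 \<le> K" using R_pos by (metis abs_ge_zero abs_zero less_imp_le order_trans)
  show "integrable M g" by (rule integrable_bounded_on[OF _ K(1)]) simp
  show "integrable M (\<lambda>x. x * g x)"
    by (rule integrable_bounded_on[where K = "R * K"])
       (use K R_pos in \<open>auto simp: abs_mult intro!: mult_mono\<close>)
  show "integrable (M \<Otimes>\<^sub>M M) (\<lambda>z. diff_quot g g' (fst z) (snd z) * (\<bar>fst z\<bar> + \<bar>snd z\<bar>))"
    by (rule integrable_pair_bounded_on[where K = "K * (2 * R)"])
       (use K \<open>0 \<le> K\<close> diff_quot_bounded[OF assms K(2)] in \<open>auto simp: abs_mult intro!: mult_mono\<close>)
qed

lemma integral_pair_mult:
  assumes "integrable M g" "integrable M h"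
  shows "integrable (M \<Otimes>\<^sub>M M) (\<lambda>z. g (fst z) * h (snd z) :: real)"
    and "(LINT z|(M \<Otimes>\<^sub>M M). g (fst z) * h (snd z)) = (LINT x|M. g x) * (LINT x|M. h x)"
proof -
  show *: "integrable (M \<Otimes>\<^sub>M M) (\<lambda>z. g (fst z) * h (snd z))"
  proof (rule pair.Fubini_integrable)
    show "(\<lambda>z. g (fst z) * h (snd z)) \<in> borel_measurable (M \<Otimes>\<^sub>M M)"
      using assms[THEN borel_measurable_integrable] by measurable
    show "integrable M (\<lambda>x. LINT y|M. norm (g (fst (x, y)) * h (snd (x, y))))"
      using assms by (simp add: abs_mult)
    show "AE x in M. integrable M (\<lambda>y. g (fst (x, y)) * h (snd (x, y)))"
      using assms by simp
  qed
  show "(LINT z|(M \<Otimes>\<^sub>M M). g (fst z) * h (snd z)) = (LINT x|M. g x) * (LINT x|M. h x)"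
    using pair.integral_fst'[OF *] by simp
qed

text \<open>Left side minus right side of the stationary identity. It is linear and, on functions
  vanishing at 0, controlled by the size of \<open>g'\<close> on \<open>[-R, R]\<close>, so it is
  determined by its values on monomials.\<close>

definition defect :: "real \<Rightarrow> real \<Rightarrow> (real \<Rightarrow> real) \<Rightarrow> (real \<Rightarrow> real) \<Rightarrow> real" where
  "defect \<alpha> \<beta> g g' = (LINT x|M. x * g x) - \<alpha> * (LINT x|M. g x) -
     \<beta> / 2 * (LINT z|(M \<Otimes>\<^sub>M M). diff_quot g g' (fst z) (snd z) * (\<bar>fst z\<bar> + \<bar>snd z\<bar>))"

lemma defect_diff:
  assumes "C1 g g'" "C1 h h'"
  shows "defect \<alpha> \<beta> (\<lambda>x. g x - h x) (\<lambda>x. g' x - h' x) = defect \<alpha> \<beta> g g' - defect \<alpha> \<beta> h h'"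
  using integrable_C1[OF assms(1)] integrable_mult_C1[OF assms(1)] integrable_diff_quot[OF assms(1)]
    integrable_C1[OF assms(2)] integrable_mult_C1[OF assms(2)] integrable_diff_quot[OF assms(2)]
  by (simp add: defect_def diff_quot_diff left_diff_distrib right_diff_distrib)

lemma defect_lincomb:
  assumes C1: "\<And>i. i \<in> I \<Longrightarrow> C1 (g i) (g' i)"
  shows "defect \<alpha> \<beta> (\<lambda>x. \<Sum>i\<in>I. c i * g i x) (\<lambda>x. \<Sum>i\<in>I. c i * g' i x) =
     (\<Sum>i\<in>I. c i * defect \<alpha> \<beta> (g i) (g' i))"
proof -
  have "(LINT x|M. x * (\<Sum>i\<in>I. c i * g i x)) = (LINT x|M. (\<Sum>i\<in>I. c i * (x * g i x)))"
    by (simp add: sum_distrib_left mult_ac)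
  also have "\<dots> = (\<Sum>i\<in>I. c i * (LINT x|M. x * g i x))"
    using integrable_mult_C1[OF C1] by (subst Bochner_Integration.integral_sum) auto
  finally have 1: "(LINT x|M. x * (\<Sum>i\<in>I. c i * g i x)) = (\<Sum>i\<in>I. c i * (LINT x|M. x * g i x))" .
  have 2: "(LINT x|M. (\<Sum>i\<in>I. c i * g i x)) = (\<Sum>i\<in>I. c i * (LINT x|M. g i x))"
    using integrable_C1[OF C1] by (subst Bochner_Integration.integral_sum) auto
  let ?D = "\<lambda>i z. diff_quot (g i) (g' i) (fst z) (snd z) * (\<bar>fst z\<bar> + \<bar>snd z\<bar>)"
  have "(LINT z|(M \<Otimes>\<^sub>M M). diff_quot (\<lambda>x. \<Sum>i\<in>I. c i * g i x) (\<lambda>x. \<Sum>i\<in>I. c i * g' i x) (fst z) (snd z) *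
      (\<bar>fst z\<bar> + \<bar>snd z\<bar>)) = (LINT z|(M \<Otimes>\<^sub>M M). (\<Sum>i\<in>I. c i * ?D i z))"
    by (simp add: diff_quot_lincomb sum_distrib_right mult.assoc)
  also have "\<dots> = (\<Sum>i\<in>I. c i * (LINT z|(M \<Otimes>\<^sub>M M). ?D i z))"
    using integrable_diff_quot[OF C1] by (subst Bochner_Integration.integral_sum) auto
  finally show ?thesis
    unfolding defect_def 1 2
    by (simp add: sum_distrib_left right_diff_distrib sum_subtractf mult_ac)
qed

text \<open>Since \<open>h 0 = 0\<close>, the mean value theorem gives
  \<open>\<bar>h x\<bar> \<le> R * \<epsilon>\<close> on the support; the quotient is at most
  \<open>\<epsilon>\<close> and its weight at most \<open>2 * R\<close>. The three constants bound
  the three terms of \<open>defect\<close>.\<close>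

lemma abs_defect_le:
  assumes "C1 h h'" "\<And>x. \<bar>x\<bar> \<le> R \<Longrightarrow> \<bar>h' x\<bar> \<le> \<epsilon>" "h 0 = 0"
  shows "\<bar>defect \<alpha> \<beta> h h'\<bar> \<le> (R * R + \<bar>\<alpha>\<bar> * R + \<bar>\<beta>\<bar> * R) * \<epsilon>"
proof -
  note [measurable] = C1_measurable[OF assms(1)]
  have "0 \<le> \<epsilon>" using assms(2)[of 0] R_pos by simp
  have h: "\<bar>h x\<bar> \<le> R * \<epsilon>" if "\<bar>x\<bar> \<le> R" for x
  proof -
    have "\<bar>h x\<bar> \<le> \<epsilon> * \<bar>x\<bar>"
      using C1_MVT[OF assms(1,2) that, of 0] R_pos assms(3) by simp
    also have "\<dots> \<le> \<epsilon> * R" using that \<open>0 \<le> \<epsilon>\<close> by (intro mult_left_mono)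
    finally show ?thesis by (simp add: mult.commute)
  qed
  have 1: "\<bar>LINT x|M. x * h x\<bar> \<le> R * (R * \<epsilon>)"
    by (rule abs_integral_le) (use h R_pos in \<open>auto simp: abs_mult intro!: mult_mono\<close>)
  have "\<bar>LINT x|M. h x\<bar> \<le> R * \<epsilon>"
    by (rule abs_integral_le) (use h in auto)
  then have 2: "\<bar>\<alpha> * (LINT x|M. h x)\<bar> \<le> \<bar>\<alpha>\<bar> * (R * \<epsilon>)"
    by (auto simp: abs_mult intro: mult_left_mono)
  have "\<bar>LINT z|(M \<Otimes>\<^sub>M M). diff_quot h h' (fst z) (snd z) * (\<bar>fst z\<bar> + \<bar>snd z\<bar>)\<bar> \<le> \<epsilon> * (2 * R)"
    by (rule abs_pair_integral_le)
       (use \<open>0 \<le> \<epsilon>\<close> diff_quot_bounded[OF assms(1,2)] in \<open>auto simp: abs_mult intro!: mult_mono\<close>)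
  then have "\<bar>\<beta> / 2\<bar> * \<bar>LINT z|(M \<Otimes>\<^sub>M M). diff_quot h h' (fst z) (snd z) * (\<bar>fst z\<bar> + \<bar>snd z\<bar>)\<bar>
      \<le> \<bar>\<beta> / 2\<bar> * (\<epsilon> * (2 * R))"
    by (intro mult_left_mono) auto
  then have 3: "\<bar>\<beta> / 2 * (LINT z|(M \<Otimes>\<^sub>M M). diff_quot h h' (fst z) (snd z) * (\<bar>fst z\<bar> + \<bar>snd z\<bar>))\<bar>
      \<le> \<bar>\<beta>\<bar> * (\<epsilon> * R)"
    by (simp add: abs_mult)
  have "\<bar>defect \<alpha> \<beta> h h'\<bar> \<le> R * (R * \<epsilon>) + \<bar>\<alpha>\<bar> * (R * \<epsilon>) + \<bar>\<beta>\<bar> * (\<epsilon> * R)"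
    unfolding defect_def
    using 1 2 3 by (intro order_trans[OF abs_triangle_ineq4] add_mono)
  then show ?thesis by (simp add: algebra_simps)
qed

text \<open>Splitting the weight \<open>\<bar>x\<bar> + \<bar>y\<bar>\<close> yields two sums that
  the reflection \<open>k \<mapsto> n - 1 - k\<close> identifies, so \<open>\<beta> / 2\<close>
  becomes \<open>\<beta>\<close>.\<close>

lemma defect_power:
  "defect \<alpha> \<beta> (\<lambda>x. x ^ n) (\<lambda>x. real n * x ^ (n - 1)) =
     (LINT x|M. x ^ Suc n) - \<alpha> * (LINT x|M. x ^ n) -
     \<beta> * (\<Sum>k<n. (LINT x|M. \<bar>x\<bar> * x ^ k) * (LINT x|M. x ^ (n - 1 - k)))"
proof -
  have int: "integrable M (\<lambda>x. x ^ k)" "integrable M (\<lambda>x. \<bar>x\<bar> * x ^ k)" for k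
  proof -
    show *: "integrable M (\<lambda>x. x ^ k)" for k by (rule integrable_C1[OF C1_power])
    have "integrable M (\<lambda>x. \<bar>x ^ Suc k\<bar>)" using *[of "Suc k"] by (rule integrable_abs)
    then show "integrable M (\<lambda>x. \<bar>x\<bar> * x ^ k)"
      by (rule Bochner_Integration.integrable_bound) (auto simp: abs_mult)
  qed
  let ?s = "\<lambda>k. (LINT x|M. \<bar>x\<bar> * x ^ k) * (LINT x|M. x ^ (n - 1 - k))"
  have "(LINT z|(M \<Otimes>\<^sub>M M). diff_quot (\<lambda>x. x ^ n) (\<lambda>x. real n * x ^ (n - 1)) (fst z) (snd z) *
      (\<bar>fst z\<bar> + \<bar>snd z\<bar>)) =
      (LINT z|(M \<Otimes>\<^sub>M M). (\<Sum>k<n. (\<bar>fst z\<bar> * fst z ^ k) * snd z ^ (n - 1 - k) +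
         fst z ^ k * (\<bar>snd z\<bar> * snd z ^ (n - 1 - k))))"
    by (simp only: diff_quot_power sum_distrib_right) (simp add: algebra_simps)
  also have "\<dots> = (\<Sum>k<n. ?s k + (LINT x|M. x ^ k) * (LINT x|M. \<bar>x\<bar> * x ^ (n - 1 - k)))"
  proof (subst Bochner_Integration.integral_sum)
    show "integrable (M \<Otimes>\<^sub>M M) (\<lambda>z. (\<bar>fst z\<bar> * fst z ^ k) * snd z ^ (n - 1 - k) +
         fst z ^ k * (\<bar>snd z\<bar> * snd z ^ (n - 1 - k)))" for k
      using integral_pair_mult(1)[OF int(2) int(1)] integral_pair_mult(1)[OF int(1) int(2)]
      by (rule Bochner_Integration.integrable_add)
    show "(\<Sum>k<n. (LINT z|(M \<Otimes>\<^sub>M M). (\<bar>fst z\<bar> * fst z ^ k) * snd z ^ (n - 1 - k) +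
         fst z ^ k * (\<bar>snd z\<bar> * snd z ^ (n - 1 - k)))) =
         (\<Sum>k<n. ?s k + (LINT x|M. x ^ k) * (LINT x|M. \<bar>x\<bar> * x ^ (n - 1 - k)))"
      by (intro sum.cong refl, subst Bochner_Integration.integral_add)
         (auto intro!: integral_pair_mult int
               simp only: integral_pair_mult(2)[OF int(2) int(1)] integral_pair_mult(2)[OF int(1) int(2)])
  qed
  also have "\<dots> = (\<Sum>k<n. ?s k) + (\<Sum>k<n. ?s k)"
    unfolding sum.distrib
    by (intro arg_cong2[where f = plus] refl
          sum.reindex_bij_witness[where i = "\<lambda>k. n - 1 - k" and j = "\<lambda>k. n - 1 - k"])
       (auto simp: mult.commute)
  finally show ?thesis by (simp add: defect_def)
qed

text \<open>Density argument: the defect vanishes on polynomials by linearity, and that of the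
  remainder is arbitrarily small by \<open>abs_defect_le\<close>.\<close>

lemma defect_eq_0:
  assumes mono: "\<And>n. defect \<alpha> \<beta> (\<lambda>x. x ^ n) (\<lambda>x. real n * x ^ (n - 1)) = 0" and g: "C1 g g'"
  shows "defect \<alpha> \<beta> g g' = 0"
proof -
  let ?C = "R * R + \<bar>\<alpha>\<bar> * R + \<bar>\<beta>\<bar> * R"
  have C: "?C > 0" using R_pos by (intro add_pos_nonneg) auto
  have "\<bar>defect \<alpha> \<beta> g g'\<bar> \<le> 0 + e" if "e > 0" for e
  proof -
    \<comment> \<open>With this accuracy the bound of \<open>abs_defect_le\<close> is exactly
      \<open>e\<close>.\<close>
    have "0 < e / ?C" using that C by simp
    then obtain n c where c: "(\<Sum>i\<le>n. c i * 0 ^ i) = g 0"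
      "\<And>x. \<bar>x\<bar> \<le> R \<Longrightarrow> \<bar>g' x - (\<Sum>i\<le>n. c i * (real i * x ^ (i - 1)))\<bar> \<le> e / ?C"
      using C1_approx_polynomial[OF g, where r = R] by blast
    let ?p = "\<lambda>x. \<Sum>i\<le>n. c i * x ^ i" and ?p' = "\<lambda>x. \<Sum>i\<le>n. c i * (real i * x ^ (i - 1))"
    have p: "C1 ?p ?p'" by (intro C1_sum C1_cmult C1_power)
    have "defect \<alpha> \<beta> ?p ?p' = 0"
      using defect_lincomb[where g = "\<lambda>i x. x ^ i" and I = "{..n}" and c = c, OF C1_power]
      by (simp only: mono mult_zero_right sum.neutral_const)
    then have "\<bar>defect \<alpha> \<beta> g g'\<bar> = \<bar>defect \<alpha> \<beta> (\<lambda>x. g x - ?p x) (\<lambda>x. g' x - ?p' x)\<bar>"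
      by (subst defect_diff[OF g p]) simp
    also have "\<dots> \<le> ?C * (e / ?C)"
      by (rule abs_defect_le[OF C1_diff[OF g p] c(2)]) (use c(1) in simp_all)
    finally show ?thesis using C by simp
  qed
  then have "\<bar>defect \<alpha> \<beta> g g'\<bar> \<le> 0" by (rule field_le_epsilon)
  then show ?thesis by simp
qed

end

section \<open>The self-similar solution\<close>

text \<open>The weight is homogeneous of degree one and absorbs the chain-rule factor
  \<open>s\<close>; this is what permits a self-similar solution. At \<open>s = 0\<close> both sides
  are 0.\<close>

lemma diff_quot_scale:
  assumes "s \<ge> 0"
  shows "diff_quot (\<lambda>x. g (s * x)) (\<lambda>x. s * g' (s * x)) x y * (\<bar>x\<bar> + \<bar>y\<bar>) =
    diff_quot g g' (s * x) (s * y) * (\<bar>s * x\<bar> + \<bar>s * y\<bar>)"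
proof (cases "s = 0")
  case False
  have abs: "\<bar>s * x\<bar> + \<bar>s * y\<bar> = s * (\<bar>x\<bar> + \<bar>y\<bar>)"
    using assms by (simp add: abs_mult distrib_left)
  have diff: "s * x - s * y = s * (x - y)"
    by (rule right_diff_distrib[symmetric])
  show ?thesis
  proof (cases "x = y")
    case True
    then show ?thesis unfolding abs by (simp add: diff_quot_def)
  next
    case neq: False
    then show ?thesis unfolding abs using False by (simp add: diff_quot_def diff)
  qed
qed (simp add: diff_quot_def)

lemma C1_scale:
  assumes "C1 g g'"
  shows "C1 (\<lambda>x. g (s * x)) (\<lambda>x. s * g' (s * x))"
proof -
  have "((\<lambda>x. g (s * x)) has_real_derivative g' (s * x) * s) (at x)" for x
    using assms by (intro DERIV_chain2[of g] DERIV_cmult_Id) (simp add: C1_def)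
  moreover have "continuous_on UNIV (\<lambda>x. s * g' (s * x))"
    using assms
    by (intro continuous_on_mult_left)
       (auto simp: C1_def intro!: continuous_on_compose2[of UNIV g' UNIV "(*) s"] continuous_intros)
  ultimately show ?thesis by (simp add: C1_def mult.commute)
qed

context bounded_real_distribution
begin

abbreviation scaled :: "real \<Rightarrow> real measure" where
  "scaled s \<equiv> distr M borel (\<lambda>x. s * x)"

lemma real_distribution_scaled: "real_distribution (scaled s)"
  by (intro real_distribution.intro prob_space_distr real_distribution_axioms.intro) simp_all

lemma scaled_0: "scaled 0 = return borel 0"
  by simp

lemma integral_scaled:
  fixes g :: "real \<Rightarrow> real"
  assumes "g \<in> borel_measurable borel"
  shows "(LINT x|scaled s. g x) = (LINT x|M. g (s * x))"
  using assms by (subst integral_distr) auto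

lemma integrable_scaled_C1:
  assumes "C1 g g'"
  shows "integrable (scaled s) g"
  by (subst integrable_distr_eq)
     (use integrable_C1[OF C1_scale[OF assms, of s]] C1_measurable(1)[OF assms] in simp_all)

text \<open>The product of the images is the image of the product, so the double integral pulls back
  to \<open>M\<close>, where \<open>diff_quot_scale\<close> rewrites the integrand.\<close>

lemma
  assumes "C1 g g'" "s \<ge> 0"
  shows integrable_scaled_diff_quot:
      "integrable (scaled s \<Otimes>\<^sub>M scaled s) (\<lambda>(x, y). diff_quot g g' x y * (\<bar>x\<bar> + \<bar>y\<bar>))" (is ?int)
    and integral_scaled_diff_quot:
      "(LINT (x, y)|(scaled s \<Otimes>\<^sub>M scaled s). diff_quot g g' x y * (\<bar>x\<bar> + \<bar>y\<bar>)) =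
       (LINT z|(M \<Otimes>\<^sub>M M). diff_quot (\<lambda>x. g (s * x)) (\<lambda>x. s * g' (s * x)) (fst z) (snd z) *
          (\<bar>fst z\<bar> + \<bar>snd z\<bar>))" (is ?eq)
proof -
  note [measurable] = C1_measurable[OF assms(1)]
  interpret S: real_distribution "scaled s" by (rule real_distribution_scaled)
  let ?h = "\<lambda>(x, y). diff_quot g g' x y * (\<bar>x\<bar> + \<bar>y\<bar>)"
  have h[measurable]: "?h \<in> borel_measurable (borel \<Otimes>\<^sub>M borel)"
    unfolding case_prod_beta by measurable
  have T[measurable]: "(\<lambda>(x, y). (s * x, s * y)) \<in> M \<Otimes>\<^sub>M M \<rightarrow>\<^sub>M borel \<Otimes>\<^sub>M borel"
    by measurable
  have pair: "scaled s \<Otimes>\<^sub>M scaled s = distr (M \<Otimes>\<^sub>M M) (borel \<Otimes>\<^sub>M borel) (\<lambda>(x, y). (s * x, s * y))"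
    by (rule pair_measure_distr) (auto intro: S.sigma_finite_measure_axioms)
  have eq: "?h (case z of (x, y) \<Rightarrow> (s * x, s * y)) =
      diff_quot (\<lambda>x. g (s * x)) (\<lambda>x. s * g' (s * x)) (fst z) (snd z) * (\<bar>fst z\<bar> + \<bar>snd z\<bar>)" for z
    using diff_quot_scale[OF assms(2), of g g' "fst z" "snd z"]
    by (simp only: case_prod_beta fst_conv snd_conv)
  show ?int
    unfolding pair integrable_distr_eq[OF T h] eq
    by (rule integrable_diff_quot[OF C1_scale[OF assms(1)]])
  show ?eq
    unfolding pair integral_distr[OF T h] eq ..
qed

text \<open>Fubini: by joint continuity \<open>h\<close> is bounded on the compact rectangle
  \<open>{-R..R} \<times> {0..t}\<close>, and the product of a probability measure with a bounded
  interval is finite.\<close>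

lemma
  fixes h :: "real \<Rightarrow> real \<Rightarrow> real"
  assumes cont: "continuous_on UNIV (\<lambda>z. h (fst z) (snd z))"
  shows set_integrable_integral:
      "set_integrable lborel {0..t} (\<lambda>s. LINT x|M. h x s)" (is ?int)
    and set_integral_integral:
      "(LINT s:{0..t}|lborel. (LINT x|M. h x s)) = (LINT x|M. (LINT s:{0..t}|lborel. h x s))" (is ?eq)
proof -
  interpret P: pair_sigma_finite M lborel ..
  have [measurable]: "(\<lambda>z. h (fst z) (snd z)) \<in> borel_measurable (M \<Otimes>\<^sub>M lborel)"
  proof -
    have "(\<lambda>z. h (fst z) (snd z)) \<in> borel_measurable borel"
      using cont by (rule borel_measurable_continuous_onI)
    moreover have "sets (M \<Otimes>\<^sub>M lborel) = sets (borel :: (real \<times> real) measure)"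
      by (subst borel_prod[symmetric], intro sets_pair_measure_cong) auto
    ultimately show ?thesis by (simp cong: measurable_cong_sets)
  qed
  have "compact ((\<lambda>z. h (fst z) (snd z)) ` ({-R..R} \<times> {0..t}))"
    using cont by (intro compact_continuous_image compact_Times) (auto intro: continuous_on_subset)
  then obtain K where K: "\<forall>y\<in>(\<lambda>z. h (fst z) (snd z)) ` ({-R..R} \<times> {0..t}). norm y \<le> K"
    using compact_imp_bounded bounded_iff by metis
  let ?H = "\<lambda>x s. indicator {0..t} s * h x s"
  have int: "integrable (M \<Otimes>\<^sub>M lborel) (\<lambda>(x, s). ?H x s)"
  proof (rule integrableI_bounded_set)
    show "space M \<times> {0..t} \<in> sets (M \<Otimes>\<^sub>M lborel)"
      by auto
    show "emeasure (M \<Otimes>\<^sub>M lborel) (space M \<times> {0..t}) < \<infinity>"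
      by (subst lborel.emeasure_pair_measure_Times) (auto simp: emeasure_space_1[simplified] emeasure_lborel_Icc_eq)
    show "(\<lambda>(x, s). ?H x s) \<in> borel_measurable (M \<Otimes>\<^sub>M lborel)"
      unfolding case_prod_beta by measurable
    have *: "AE z in M \<Otimes>\<^sub>M lborel. \<bar>fst z\<bar> \<le> R"
    proof (rule P.AE_pair_measure)
      show "AE x in M. AE y in lborel. \<bar>fst (x, y)\<bar> \<le> R"
        using AE_bounded by eventually_elim simp
    qed measurable
    have "norm (case z of (x, s) \<Rightarrow> ?H x s) \<le> K" if "\<bar>fst z\<bar> \<le> R" "z \<in> space M \<times> {0..t}" for z
      using K that by (auto simp: abs_le_iff minus_le_iff)
    with * show "AE z in M \<Otimes>\<^sub>M lborel. z \<in> space M \<times> {0..t} \<longrightarrow> norm (case z of (x, s) \<Rightarrow> ?H x s) \<le> K"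
      by (auto elim!: eventually_mono)
  qed (auto intro!: AE_I2 simp: space_pair_measure indicator_def)
  show ?int
    using P.integrable_snd[OF int] by (simp add: set_integrable_def)
  show ?eq
    using P.Fubini_integral[OF int] by (simp add: set_lebesgue_integral_def)
qed

text \<open>Take expectations in \<open>f (t * x) - f 0 = \<integral> x * f1 (s * x) ds\<close> over
  \<open>{0..t}\<close>, then rewrite the integrand by the stationary identity for
  \<open>g(x) = f1 (s * x)\<close>.\<close>

lemma scaled_satisfies_evolution:
  assumes defect: "\<And>g g'. C1 g g' \<Longrightarrow> defect \<alpha> \<beta> g g' = 0" and "\<beta> \<noteq> 0"
    and f: "C1 f f1" and f1: "C1 f1 f2" and "t \<ge> 0"
  shows "satisfies_evolution \<beta> \<alpha> scaled t f f1 f2"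
proof -
  note [measurable] = C1_measurable[OF f] C1_measurable[OF f1]
  note cont = continuous_on_compose2[OF C1_continuous[OF f1]]
  define I where "I s = (LINT x|M. x * f1 (s * x))" for s
  define J where "J s = (LINT x|scaled s. f1 x)" for s
  define D where "D s = (LINT (x, y)|(scaled s \<Otimes>\<^sub>M scaled s). diff_quot f1 f2 x y * (\<bar>x\<bar> + \<bar>y\<bar>))" for s
  \<comment> \<open>The stationary identity solved for the interaction term: its integrability in
    time is thereby inherited from \<open>I\<close> and \<open>J\<close>.\<close>
  have D: "D s = 2 / \<beta> * (I s - \<alpha> * J s)" if "s \<ge> 0" for s
    using defect[OF C1_scale[OF f1, of s]] \<open>\<beta> \<noteq> 0\<close>
    unfolding D_def integral_scaled_diff_quot[OF f1 that] defect_def I_def J_def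
    by (simp add: integral_scaled field_simps)
  have I_int: "set_integrable lborel {0..t} I"
    unfolding I_def by (intro set_integrable_integral continuous_intros cont) auto
  have J_eq: "J = (\<lambda>s. LINT x|M. f1 (s * x))"
    by (simp add: J_def integral_scaled fun_eq_iff)
  have J_int: "set_integrable lborel {0..t} J"
    unfolding J_eq by (intro set_integrable_integral continuous_intros cont) auto
  have D_int: "set_integrable lborel {0..t} D"
  proof (subst set_integrable_cong[OF refl refl])
    show "D s = 2 / \<beta> * (I s - \<alpha> * J s)" if "s \<in> {0..t}" for s using D that by simp
    show "set_integrable lborel {0..t} (\<lambda>s. 2 / \<beta> * (I s - \<alpha> * J s))"
      using I_int J_int by (intro set_integrable_mult_right set_integral_diff) auto
  qed
  have "(LINT s:{0..t}|lborel. D s) = (LINT s:{0..t}|lborel. 2 / \<beta> * (I s - \<alpha> * J s))"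
    by (rule set_lebesgue_integral_cong) (auto simp: D)
  also have "\<dots> = 2 / \<beta> * ((LINT s:{0..t}|lborel. I s) - \<alpha> * (LINT s:{0..t}|lborel. J s))"
    using I_int J_int by (simp add: set_integral_diff)
  finally have D_integral: "(LINT s:{0..t}|lborel. I s) =
      \<alpha> * (LINT s:{0..t}|lborel. J s) + \<beta> / 2 * (LINT s:{0..t}|lborel. D s)"
    using \<open>\<beta> \<noteq> 0\<close> by (simp add: field_simps)
  \<comment> \<open>For fixed \<open>x\<close>, the curve \<open>s \<mapsto> f (s * x)\<close> has
    derivative \<open>x * f1 (s * x)\<close>.\<close>
  have FTC: "(LINT s:{0..t}|lborel. x * f1 (s * x)) = f (t * x) - f 0" for x
  proof -
    have "(LINT s|lborel. (x * f1 (s * x)) * indicator {0..t} s) = f (t * x) - f (0 * x)"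
    proof (rule integral_FTC_Icc_real)
      show "((\<lambda>s. f (s * x)) has_real_derivative x * f1 (s * x)) (at s)" for s
        using C1_scale[OF f, of x] by (simp add: C1_def mult.commute)
      show "isCont (\<lambda>s. x * f1 (s * x)) s" for s
        using cont[of UNIV "\<lambda>s. s * x"]
        by (intro continuous_intros) (auto simp: continuous_on_eq_continuous_at intro!: continuous_intros)
    qed fact
    then show ?thesis
      by (simp only: set_lebesgue_integral_def real_scaleR_def mult_zero_left
            mult.commute[of "indicator {0..t} s" "x * f1 (s * x)" for s])
  qed
  have "(LINT s:{0..t}|lborel. I s) = (LINT x|M. f (t * x) - f 0)"
    unfolding I_def FTC[symmetric] by (intro set_integral_integral continuous_intros cont) auto
  also have "\<dots> = (LINT x|M. f (t * x)) - f 0"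
    using integrable_C1[OF C1_scale[OF f, of t]] prob_space by simp
  finally have "(LINT x|scaled t. f x) = (LINT x|scaled 0. f x) + (LINT s:{0..t}|lborel. I s)"
    using prob_space by (simp only: integral_scaled[OF C1_measurable(1)[OF f]]) simp
  then have eq: "(LINT x|scaled t. f x) = (LINT x|scaled 0. f x) +
      \<alpha> * (LINT s:{0..t}|lborel. J s) + \<beta> / 2 * (LINT s:{0..t}|lborel. D s)"
    by (simp only: D_integral add.assoc)
  show ?thesis
    unfolding satisfies_evolution_def
    by (intro conjI ballI integrable_scaled_C1[OF f] integrable_scaled_C1[OF f1]
          J_int[unfolded J_def] D_int[unfolded D_def] eq[unfolded J_def D_def]
          integrable_scaled_diff_quot[OF f1]) simp
qed

section \<open>Weak continuity and the mass of the negative half-line\<close>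

lemma weakly_continuous_scaled: "weakly_continuous scaled"
  unfolding weakly_continuous_def
proof (intro allI impI continuous_on_sequentiallyI)
  fix g :: "real \<Rightarrow> real" and u :: "nat \<Rightarrow> real" and a :: real
  assume g: "continuous_on UNIV g" "bounded (range g)" and u: "u \<longlonglongrightarrow> a"
  from g(2) obtain K where K: "\<And>x. norm (g x) \<le> K"
    by (auto simp: bounded_iff)
  have [measurable]: "g \<in> borel_measurable borel"
    using g(1) by (rule borel_measurable_continuous_onI)
  have "(\<lambda>n. LINT x|M. g (u n * x)) \<longlonglongrightarrow> (LINT x|M. g (a * x))"
  proof (rule integral_dominated_convergence[where w = "\<lambda>_. K"])
    show "AE x in M. (\<lambda>n. g (u n * x)) \<longlonglongrightarrow> g (a * x)"
      by (intro AE_I2 continuous_on_tendsto_compose[OF g(1)] tendsto_mult u tendsto_const) auto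
  qed (use K in auto)
  then show "(\<lambda>n. LINT x|scaled (u n). g x) \<longlonglongrightarrow> (LINT x|scaled a. g x)"
    by (simp add: integral_scaled)
qed

lemma measure_scaled_neg: "t > 0 \<Longrightarrow> measure (scaled t) {..<0} = measure M {..<0}"
  by (subst measure_distr) (auto intro!: arg_cong[where f = prob] simp: mult_less_0_iff)

text \<open>Without negative mass \<open>\<bar>x\<bar> = x\<close> almost surely. This reduces
  positivity to a comparison of two moments that are already known.\<close>

lemma measure_neg_pos:
  assumes "(LINT x|M. \<bar>x\<bar>) \<noteq> (LINT x|M. x)"
  shows "measure M {..<0} > 0"
proof (rule ccontr)
  assume "\<not> 0 < measure M {..<0}"
  then have "emeasure M {..<0} = 0"
    by (simp add: emeasure_eq_measure measure_nonneg order.antisym not_less)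
  then have "AE x in M. x \<notin> {..<0}"
    by (intro AE_not_in) (auto simp: null_sets_def)
  then have "(LINT x|M. \<bar>x\<bar>) = (LINT x|M. x)"
    by (intro integral_cong_AE) auto
  with assms show False by simp
qed

end

theorem proposition6:
  fixes \<alpha> \<beta> :: real
  assumes "\<beta> \<in> {1, 2}" and "\<alpha> \<in> {0..<1}"
  shows "\<exists>\<mu> :: real \<Rightarrow> real measure.
           (\<forall>t\<ge>0. real_distribution (\<mu> t)) \<and>
           weakly_continuous \<mu> \<and>
           \<mu> 0 = return borel 0 \<and>
           (\<forall>t\<ge>0. \<forall>f f1 f2. test_function f f1 f2 \<longrightarrow> satisfies_evolution \<beta> \<alpha> \<mu> t f f1 f2) \<and>
           (\<forall>t>0. measure (\<mu> t) {..<0} > 0)"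
proof -
  \<comment> \<open>Chosen so that \<open>A - B = \<beta>\<close>, which normalises the masses, and
    \<open>A + B = \<alpha>\<close>, which matches the drift. The sign \<open>B < 0\<close> comes
    from \<open>\<alpha> < 1 \<le> \<beta>\<close>.\<close>
  define A where "A = (\<beta> + \<alpha>) / 2"
  define B where "B = (\<alpha> - \<beta>) / 2"
  have \<beta>: "\<beta> \<noteq> 0" "A - B = \<beta>" and \<alpha>: "A + B = \<alpha>"
    using assms by (auto simp: A_def B_def field_simps)
  have AB: "A > 0" "B < 0" using assms by (auto simp: A_def B_def)
  let ?M = "two_sided_law A B"
  interpret bounded_real_distribution ?M "4 * (A - B)"
    by (rule bounded_real_distribution_two_sided_law[OF AB])
  have m: "(LINT x|?M. x ^ n) = (A ^ Suc n - B ^ Suc n) * catalan n / \<beta>" for n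
    using moment_two_sided_law[OF AB, of n] \<beta> by (simp add: field_simps)
  have l: "(LINT x|?M. \<bar>x\<bar> * x ^ n) = (A ^ (n + 2) + B ^ (n + 2)) * catalan (Suc n) / \<beta>" for n
    using abs_moment_two_sided_law[OF AB, of n] \<beta> by (simp add: field_simps)
  have "defect \<alpha> \<beta> (\<lambda>x. x ^ n) (\<lambda>x. real n * x ^ (n - 1)) = 0" for n
  proof -
    let ?T = "\<lambda>k. (A ^ Suc k + B ^ Suc k) * (A ^ Suc (n - k) - B ^ Suc (n - k)) *
            (catalan k * catalan (n - k))"
    \<comment> \<open>The term \<open>k = 0\<close> carries the factor
      \<open>A + B = \<alpha>\<close> and is the drift; the shifted rest is the interaction sum of
      \<open>defect_power\<close>.\<close>
    have "(\<Sum>k\<le>n. ?T k) = ?T 0 + (\<Sum>k<n. ?T (Suc k))"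
      by (cases n) (simp_all only: sum.atMost_Suc_shift lessThan_Suc_atMost, simp_all)
    moreover have "?T (Suc k) = \<beta> * \<beta> * ((LINT x|?M. \<bar>x\<bar> * x ^ k) * (LINT x|?M. x ^ (n - 1 - k)))"
      if "k < n" for k
    proof -
      have "Suc (n - 1 - k) = Suc (n - Suc k)" by simp
      then show ?thesis using \<beta>(1) unfolding m l by (simp add: field_simps)
    qed
    moreover have "?T 0 = \<alpha> * \<beta> * (LINT x|?M. x ^ n)"
      using \<beta>(1) unfolding m \<alpha>[symmetric] by simp
    moreover have "(A ^ (n + 2) - B ^ (n + 2)) * catalan (Suc n) = \<beta> * (LINT x|?M. x ^ Suc n)"
      using \<beta>(1) unfolding m by simp
    \<comment> \<open>\<open>catalan_moment_identity\<close> divided once by \<open>\<beta>\<close>;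
      cancelling the remaining factor gives the stationary identity for
      \<open>x ^ n\<close>.\<close>
    ultimately have "\<beta> * (LINT x|?M. x ^ Suc n) = \<beta> * (\<alpha> * (LINT x|?M. x ^ n) +
        \<beta> * (\<Sum>k<n. (LINT x|?M. \<bar>x\<bar> * x ^ k) * (LINT x|?M. x ^ (n - 1 - k))))"
      using catalan_moment_identity[where A = A and B = B and n = n]
      by (simp add: sum_distrib_left distrib_left mult.assoc mult.left_commute[of \<beta> \<alpha>])
    then show ?thesis
      using \<beta>(1) unfolding defect_power mult_cancel_left by simp
  qed
  then have defect: "defect \<alpha> \<beta> g g' = 0" if "C1 g g'" for g g'
    using that by (rule defect_eq_0)
  have "satisfies_evolution \<beta> \<alpha> scaled t f f1 f2" if "t \<ge> 0" "test_function f f1 f2" for t f f1 f2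
  proof (rule scaled_satisfies_evolution[OF defect \<beta>(1)])
    show "C1 f1 f2" using that(2) by (simp add: test_function_def C1_def)
    then have "continuous_on UNIV f1" by (rule C1_continuous)
    then show "C1 f f1" using that(2) by (simp add: test_function_def C1_def)
  qed (use that in auto)
  moreover have "measure ?M {..<0} > 0"
  proof (rule measure_neg_pos)
    have "catalan (Suc 0) = 1" using catalan_Suc[of 0] by simp
    \<comment> \<open>The squares of \<open>A\<close> cancel between \<open>A ^ 2 + B ^ 2\<close>
      and \<open>A ^ 2 - B ^ 2\<close>, leaving the contribution of the negative side.\<close>
    then have "\<beta> * (LINT x|?M. \<bar>x\<bar>) - \<beta> * (LINT x|?M. x) = 2 * (B * B)"
      using l[of 0] m[of 1] \<beta>(1) by simp
    moreover have "B * B > 0" using AB by (intro mult_neg_neg)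
    ultimately show "(LINT x|?M. \<bar>x\<bar>) \<noteq> (LINT x|?M. x)" by auto
  qed
  ultimately show ?thesis
    using real_distribution_scaled weakly_continuous_scaled scaled_0 measure_scaled_neg
    by (intro exI[of _ scaled]) auto
qed

end
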